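(* Let $p$ be a fixed odd prime, let $q\in\mathbb{C}_p$ with $|q-1|_p<1$, and let the $q$-Euler numbers $\widetilde{E}_{n,q}$ ($n\ge 0$) be defined by $$\frac{[2]_q}{qe^{t}+1}=\sum_{n=0}^{\infty}\widetilde{E}_{n,q}\frac{t^n}{n!},\qquad [2]_q=1+q.$$ Then for every natural number $k\ge 1$, $$[2]_q\sum_{j=0}^{\lfloor k/2\rfloor}\binom{k}{2j}\frac{\widetilde{E}_{2k-2j+1,q}}{2k-2j+1}+(q-1)\sum_{j=0}^{\lfloor k/2\rfloor}\binom{k}{2j+1}\frac{\widetilde{E}_{2k-2j,q}}{2k-2j}=\frac{q(-1)^{k+1}}{(2k+1)\binom{2k}{k}}.$$
   Context: $\mathbb{C}_p$ is the completion of an algebraic closure of $\mathbb{Q}_p$, and $|\cdot|_p$ is the $p$-adic absolute value with $|p|_p=1/p$. The generating function is a formal power series in $t$. $\lfloor\cdot\rfloor$ is the floor (Gauss) symbol, and $\binom{k}{i}=0$ for $i>k$. *)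

theory Defs
  imports
    "HOL-Analysis.Analysis"
    "HOL-Algebra.Algebraic_Closure_Type"
    "HOL-Computational_Algebra.Computational_Algebra"
begin

definition padic_abs_rat :: "nat \<Rightarrow> rat \<Rightarrow> real" where
  "padic_abs_rat p r =
     (if r = 0 then 0
      else real p powi (int (multiplicity (int p) (snd (quotient_of r)))
                      - int (multiplicity (int p) (fst (quotient_of r)))))"

locale nonarch_absolute_value =
  fixes v :: "'a::field \<Rightarrow> real"
  assumes nonneg: "v x \<ge> 0"
    and eq_0_iff: "v x = 0 \<longleftrightarrow> x = 0"
    and mult: "v (x * y) = v x * v y"
    and ultrametric: "v (x + y) \<le> max (v x) (v y)"
begin

lemma v_1: "v 1 = 1"
  using mult[of 1 1] eq_0_iff[of 1] by simp

lemma v_minus: "v (- x) = v x"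
proof -
  have "v (- 1) * v (- 1) = 1"
    using mult[of "- 1" "- 1"] v_1 by simp
  hence "v (- 1) = 1"
    using nonneg[of "- 1"] by (metis abs_of_nonneg abs_one abs_mult_self_eq real_sqrt_abs2 real_sqrt_one)
  thus ?thesis
    using mult[of "- 1" x] by simp
qed

lemma metric: "Metric_space S (\<lambda>x y. v (x - y))"
proof
  fix x y z :: 'a
  show "v (x - y) = v (y - x)"
    using v_minus[of "x - y"] by simp
  show "v (x - z) \<le> v (x - y) + v (y - z)"
    using ultrametric[of "x - y" "y - z"] nonneg[of "x - y"] nonneg[of "y - z"] by auto
qed (auto simp: nonneg eq_0_iff)

end

text \<open>\<open>T\<close> is a completion of its subset \<open>S\<close> with respect to the metric \<open>v (x - y)\<close>.\<close>

definition is_completion :: "('a::field \<Rightarrow> real) \<Rightarrow> 'a set \<Rightarrow> 'a set \<Rightarrow> bool" where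
  "is_completion v S T \<longleftrightarrow>
     S \<subseteq> T \<and>
     Metric_space.mcomplete T (\<lambda>x y. v (x - y)) \<and>
     Metric_space.mtopology T (\<lambda>x y. v (x - y)) closure_of S = T"

definition is_algebraic_closure :: "'a::field set \<Rightarrow> 'a set \<Rightarrow> bool" where
  "is_algebraic_closure F A \<longleftrightarrow>
     algebraic_closure ((ring_of_type_algebra :: 'a ring)\<lparr>carrier := A\<rparr>) F"

text \<open>
  The type \<open>'a\<close> with the absolute value \<open>v\<close> is a model of \<open>\<complex>\<^sub>p\<close>, i.e. it is a completion of an
  algebraic closure \<open>A\<close> of a completion \<open>Qp\<close> of the rationals at \<open>p\<close>. Since \<open>\<complex>\<^sub>p\<close> depends on \<open>p\<close>,
  it is described as a structure on a type rather than as a fixed type. These conditions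
  determine the pair \<open>('a, v)\<close> up to isometric isomorphism.
\<close>

definition is_Cp :: "nat \<Rightarrow> ('a::field_char_0 \<Rightarrow> real) \<Rightarrow> bool" where
  "is_Cp p v \<longleftrightarrow>
     nonarch_absolute_value v \<and>
     (\<forall>r. v (of_rat r) = padic_abs_rat p r) \<and>
     (\<exists>Qp A. is_completion v (range of_rat) Qp \<and>
             is_algebraic_closure Qp A \<and>
             is_completion v A UNIV)"

definition q_Euler :: "nat \<Rightarrow> 'a::field_char_0 \<Rightarrow> 'a" where
  "q_Euler n q = fact n * fps_nth (fps_const (1 + q) / (fps_const q * fps_exp 1 + 1)) n"

lemma q_Euler_generating_function:
  "fps_const (1 + q) / (fps_const q * fps_exp 1 + 1) = Abs_fps (\<lambda>n. q_Euler n q / fact n)"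
  by (simp add: q_Euler_def fps_eq_iff)

lemma padic_abs_rat_prime:
  assumes "Factorial_Ring.prime p"
  shows "padic_abs_rat p (of_nat p) = 1 / real p"
proof -
  have "quotient_of (of_nat p :: rat) = (int p, 1)"
    by (simp add: of_nat_rat quotient_of_Fract Rat.normalize_def)
  moreover have "multiplicity (int p) (int p) = 1" "multiplicity (int p) 1 = 0"
    using assms by (auto intro!: multiplicity_self not_dvd_imp_multiplicity_0
        simp: prime_gt_0_nat not_prime_1 dest: prime_gt_1_nat)
  ultimately show ?thesis
    using assms by (auto simp: padic_abs_rat_def power_int_minus divide_simps dest: prime_gt_0_nat)
qed

end

theory Submission
  imports Defs
begin

text \<open>
  Let \<open>L\<close> be the linear functional on polynomials with \<open>L (x^n) = q_Euler n q\<close>. The functional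
  equation of the generating function says \<open>q L(f(x + 1)) + L(f) = (1 + q) f(0)\<close>. Applied to the
  antiderivative \<open>F\<close> of \<open>f\<close> with \<open>F(0) = 0\<close>, and because \<open>F(x + 1) - F(1)\<close> is the antiderivative of
  \<open>f(x + 1)\<close> that vanishes at \<open>0\<close>, it gives \<open>q L(\<integral> f(x + 1)) + L(\<integral> f) = - q F(1)\<close>.
  For \<open>f = x^m (x - 1)^n\<close> both antiderivatives expand by the binomial theorem, and \<open>F(1)\<close> is a
  Beta integral, evaluated by repeated integration by parts. In the case \<open>m = n = k\<close>
  the terms with even and odd index carry the factors \<open>q + 1\<close> and \<open>q - 1\<close>.

  The absolute value enters only through \<open>q \<noteq> - 1\<close>, which makes \<open>q e^t + 1\<close> a unit: for odd \<open>p\<close>,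
  \<open>- 2\<close> has absolute value \<open>1\<close>.
\<close>

hide_const (open) up_ring.coeff up_ring.monom Polynomials.degree module.smult

definition moment_functional :: "(nat \<Rightarrow> 'a::comm_semiring_0) \<Rightarrow> 'a poly \<Rightarrow> 'a" where
  "moment_functional m f = (\<Sum>i\<le>degree f. coeff f i * m i)"

lemma moment_functional_altdef:
  assumes "degree f \<le> n"
  shows "moment_functional m f = (\<Sum>i\<le>n. coeff f i * m i)"
  unfolding moment_functional_def
  by (rule sum.mono_neutral_left) (use assms in \<open>auto simp: coeff_eq_0\<close>)

lemma moment_functional_0 [simp]: "moment_functional m 0 = 0"
  by (simp add: moment_functional_def)

lemma moment_functional_const [simp]: "moment_functional m [:c:] = c * m 0"
  by (simp add: moment_functional_def)

lemma moment_functional_add: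
  "moment_functional m (f + g) = moment_functional m f + moment_functional m g"
proof -
  let ?n = "max (degree f) (degree g)"
  have "degree (f + g) \<le> ?n"
    by (simp add: degree_add_le)
  then show ?thesis
    by (simp add: moment_functional_altdef[of _ ?n] sum.distrib algebra_simps)
qed

lemma moment_functional_diff:
  "moment_functional m (f - g) = moment_functional m f - moment_functional m g"
  for m :: "nat \<Rightarrow> 'a::comm_ring"
  using moment_functional_add[of m "f - g" g] by (simp add: algebra_simps)

lemma moment_functional_smult:
  "moment_functional m (smult c f) = c * moment_functional m f"
  by (simp add: moment_functional_altdef[of _ "degree f"] degree_smult_le
      sum_distrib_left mult.assoc)

lemma moment_functional_sum:
  "moment_functional m (\<Sum>i\<in>A. f i) = (\<Sum>i\<in>A. moment_functional m (f i))"
  by (induction A rule: infinite_finite_induct) (auto simp: moment_functional_add)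

lemma moment_functional_monom_mult:
  "moment_functional m (monom 1 n * f) = moment_functional (\<lambda>i. m (n + i)) f"
  for m :: "nat \<Rightarrow> 'a::comm_semiring_1"
proof -
  have "degree (monom 1 n * f) \<le> n + degree f"
    using degree_mult_le[of "monom 1 n" f] degree_monom_le[of "1::'a" n] by simp
  then have "moment_functional m (monom 1 n * f) =
      (\<Sum>i\<le>n + degree f. coeff (monom 1 n * f) i * m i)"
    by (rule moment_functional_altdef)
  also have "\<dots> = (\<Sum>i=n..n + degree f. coeff f (i - n) * m i)"
    by (rule sum.mono_neutral_cong_right) (auto simp: coeff_monom_mult)
  also have "\<dots> = moment_functional (\<lambda>i. m (n + i)) f"
    unfolding moment_functional_def
    by (rule sum.reindex_bij_witness[of _ "\<lambda>i. n + i" "\<lambda>i. i - n"]) auto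
  finally show ?thesis .
qed

lemma moment_functional_linear_power:
  "moment_functional m ([:a, 1:] ^ n) = (\<Sum>i\<le>n. of_nat (n choose i) * a ^ (n - i) * m i)"
  for m :: "nat \<Rightarrow> 'a::comm_semiring_1"
  by (simp add: moment_functional_def degree_linear_power coeff_linear_poly_power)

lemma moment_functional_pcompose:
  "moment_functional m (pcompose f g) = moment_functional (\<lambda>i. moment_functional m (g ^ i)) f"
  for m :: "nat \<Rightarrow> 'a::comm_semiring_1"
proof -
  have "pcompose f g = (\<Sum>i\<le>degree f. smult (coeff f i) (g ^ i))"
    by (simp add: pcompose_altdef poly_altdef coeff_map_poly degree_map_poly)
  then show ?thesis
    by (simp add: moment_functional_sum moment_functional_smult moment_functional_def[of _ f])
qed

definition poly_antideriv :: "'a::field_char_0 poly \<Rightarrow> 'a poly" where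
  "poly_antideriv f = (\<Sum>i\<le>degree f. monom (coeff f i / of_nat (Suc i)) (Suc i))"

lemma coeff_poly_antideriv_0 [simp]: "coeff (poly_antideriv f) 0 = 0"
  by (simp add: poly_antideriv_def coeff_sum)

lemma coeff_poly_antideriv_Suc [simp]:
  "coeff (poly_antideriv f) (Suc n) = coeff f n / of_nat (Suc n)"
  by (auto simp add: poly_antideriv_def coeff_sum if_distrib coeff_eq_0 not_le cong: if_cong)

lemma pderiv_poly_antideriv: "pderiv (poly_antideriv f) = f"
  by (rule poly_eqI) (simp add: coeff_pderiv del: of_nat_Suc)

lemma poly_antideriv_eqI:
  assumes "pderiv F = f" and "coeff F 0 = 0"
  shows "poly_antideriv f = F"
proof (rule poly_eqI)
  fix n
  show "coeff (poly_antideriv f) n = coeff F n"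
    using assms by (cases n) (auto simp: coeff_pderiv simp del: of_nat_Suc)
qed

lemma poly_antideriv_pderiv: "poly_antideriv (pderiv f) = f - [:coeff f 0:]"
  by (rule poly_antideriv_eqI) (simp_all add: pderiv_diff pderiv_pCons)

lemma poly_antideriv_add: "poly_antideriv (f + g) = poly_antideriv f + poly_antideriv g"
  by (rule poly_antideriv_eqI) (simp_all add: pderiv_add pderiv_poly_antideriv)

lemma poly_antideriv_smult: "poly_antideriv (smult c f) = smult c (poly_antideriv f)"
  by (rule poly_antideriv_eqI) (simp_all add: pderiv_smult pderiv_poly_antideriv)

lemma poly_antideriv_pcompose_shift:
  "poly_antideriv (pcompose f [:a, 1:]) =
     pcompose (poly_antideriv f) [:a, 1:] - [:poly (poly_antideriv f) a:]"
  by (rule poly_antideriv_eqI)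
    (simp_all add: pderiv_diff pderiv_pcompose pderiv_pCons pderiv_poly_antideriv
      poly_pcompose flip: poly_0_coeff_0)

lemma moment_functional_poly_antideriv:
  "moment_functional m (poly_antideriv f) = moment_functional (\<lambda>i. m (Suc i) / of_nat (Suc i)) f"
proof -
  have "degree (poly_antideriv f) \<le> Suc (degree f)"
    unfolding poly_antideriv_def
    by (intro degree_sum_le order.trans[OF degree_monom_le]) auto
  then have "moment_functional m (poly_antideriv f) =
      (\<Sum>i\<le>Suc (degree f). coeff (poly_antideriv f) i * m i)"
    by (rule moment_functional_altdef)
  then show ?thesis
    by (simp add: sum.atMost_Suc_shift moment_functional_def del: sum.atMost_Suc of_nat_Suc)
qed

lemma poly_antideriv_beta_integral:
  "poly (poly_antideriv (monom 1 m * [:- 1, 1:] ^ n)) 1 =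
     ((- 1) ^ n * fact m * fact n / fact (m + n + 1) :: 'a::field_char_0)"
proof (induction n arbitrary: m)
  case 0
  have "poly_antideriv (monom (1 :: 'a) m) = monom (1 / of_nat (Suc m)) (Suc m)"
    by (rule poly_antideriv_eqI) (simp_all add: pderiv_monom del: of_nat_Suc)
  then show ?case
    by (simp add: poly_monom)
next
  case (Suc n)
  define B :: "nat \<Rightarrow> nat \<Rightarrow> 'a"
    where "B = (\<lambda>m n. poly (poly_antideriv (monom 1 m * [:- 1, 1:] ^ n)) 1)"
  let ?f = "monom 1 (Suc m) * [:- 1, 1:] ^ Suc n :: 'a poly"
  have "pderiv ?f = smult (of_nat (Suc m)) (monom 1 m * [:- 1, 1:] ^ Suc n) +
      smult (of_nat (Suc n)) (monom 1 (Suc m) * [:- 1, 1:] ^ n)"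
    by (simp add: pderiv_mult pderiv_power_Suc pderiv_monom pderiv_pCons smult_monom
        algebra_simps flip: mult_smult_left del: power_Suc of_nat_Suc)
  then have "poly (poly_antideriv (pderiv ?f)) 1 =
      of_nat (Suc m) * B m (Suc n) + of_nat (Suc n) * B (Suc m) n"
    by (simp only: B_def poly_antideriv_add poly_antideriv_smult poly_add poly_smult)
  moreover have "poly (poly_antideriv (pderiv ?f)) 1 = 0"
    by (simp add: poly_antideriv_pderiv poly_monom flip: poly_0_coeff_0)
  ultimately have "of_nat (Suc m) * B m (Suc n) = - of_nat (Suc n) * B (Suc m) n"
    by (simp add: eq_neg_iff_add_eq_0 del: of_nat_Suc)
  also have "B (Suc m) n = (- 1) ^ n * fact (Suc m) * fact n / fact (m + Suc n + 1)"
    unfolding B_def Suc.IH by simp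
  finally have "of_nat (Suc m) * B m (Suc n) =
      of_nat (Suc m) * ((- 1) ^ Suc n * fact m * fact (Suc n) / fact (m + Suc n + 1))"
    by (simp add: algebra_simps del: of_nat_Suc)
  then show ?case
    unfolding B_def by (simp only: mult_cancel_left of_nat_eq_0_iff) simp
qed

lemma q_Euler_0:
  assumes "q \<noteq> - 1"
  shows "q_Euler 0 q = 1"
  using assms by (simp add: q_Euler_def add_eq_0_iff2)

lemma q_Euler_recurrence:
  fixes q :: "'a::field_char_0"
  assumes "q \<noteq> - 1"
  shows "q * (\<Sum>i\<le>n. of_nat (n choose i) * q_Euler i q) + q_Euler n q =
    (if n = 0 then 1 + q else 0)"
proof -
  define D where "D = fps_const q * fps_exp 1 + 1"
  define F where "F = Abs_fps (\<lambda>n. q_Euler n q / fact n)"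
  have "fps_nth D 0 \<noteq> 0"
    using assms by (simp add: D_def add_eq_0_iff2)
  then have "F * D = fps_const (1 + q)"
    by (simp add: F_def D_def unit_imp_dvd fps_is_unit_iff flip: q_Euler_generating_function)
  then have "fps_const q * (F * fps_exp 1) + F = fps_const (1 + q)"
    by (simp add: D_def algebra_simps)
  then have "q * fps_nth (F * fps_exp 1) n + fps_nth F n = fps_nth (fps_const (1 + q)) n"
    by (metis fps_add_nth fps_mult_left_const_nth)
  then have "q * (fact n * fps_nth (F * fps_exp 1) n) + fact n * fps_nth F n =
      fact n * fps_nth (fps_const (1 + q)) n"
    by (metis distrib_left mult.left_commute)
  moreover have "fact n * fps_nth (F * fps_exp 1) n = (\<Sum>i\<le>n. of_nat (n choose i) * q_Euler i q)"
    unfolding fps_mult_nth sum_distrib_left atLeast0AtMost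
    by (rule sum.cong) (auto simp: F_def binomial_fact)
  moreover have "fact n * fps_nth F n = q_Euler n q"
    by (simp add: F_def)
  ultimately show ?thesis
    by simp
qed

definition q_Euler_functional :: "'a::field_char_0 \<Rightarrow> 'a poly \<Rightarrow> 'a" where
  "q_Euler_functional q = moment_functional (\<lambda>n. q_Euler n q)"

lemma q_Euler_functional_shift:
  assumes "q \<noteq> - 1"
  shows "q * q_Euler_functional q (pcompose f [:1, 1:]) + q_Euler_functional q f =
    (1 + q) * coeff f 0"
proof -
  let ?E = "\<lambda>i. q_Euler_functional q ([:1, 1:] ^ i)"
  have "q * q_Euler_functional q (pcompose f [:1, 1:]) + q_Euler_functional q f =
      (\<Sum>i\<le>degree f. coeff f i * (q * ?E i + q_Euler i q))"
    unfolding q_Euler_functional_def moment_functional_pcompose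
    by (simp add: moment_functional_def[of _ f] sum_distrib_left sum.distrib algebra_simps)
  also have "\<dots> = (\<Sum>i\<le>degree f. if i = 0 then coeff f i * (1 + q) else 0)"
    by (rule sum.cong)
      (simp_all add: q_Euler_functional_def moment_functional_linear_power
        q_Euler_recurrence[OF assms])
  finally show ?thesis
    by simp
qed

lemma q_Euler_functional_antideriv_shift:
  assumes "q \<noteq> - 1"
  shows "q * q_Euler_functional q (poly_antideriv (pcompose f [:1, 1:])) +
    q_Euler_functional q (poly_antideriv f) = - q * poly (poly_antideriv f) 1"
  using q_Euler_functional_shift[OF assms, of "poly_antideriv f"]
  by (simp add: poly_antideriv_pcompose_shift q_Euler_functional_def moment_functional_diff
      q_Euler_0[OF assms] algebra_simps)

lemma q_Euler_functional_antideriv_linear_power: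
  "q_Euler_functional q (poly_antideriv (monom 1 m * [:a, 1:] ^ n)) =
     (\<Sum>i\<le>n. of_nat (n choose i) * a ^ (n - i) * (q_Euler (m + i + 1) q / of_nat (m + i + 1)))"
  by (simp add: q_Euler_functional_def moment_functional_poly_antideriv moment_functional_monom_mult
      moment_functional_linear_power del: of_nat_Suc)

lemma q_Euler_binomial_sum:
  fixes q :: "'a::field_char_0"
  assumes "q \<noteq> - 1"
  shows "q * (\<Sum>i\<le>m. of_nat (m choose i) * (q_Euler (n + i + 1) q / of_nat (n + i + 1))) +
      (\<Sum>i\<le>n. of_nat (n choose i) * (- 1) ^ (n - i) * (q_Euler (m + i + 1) q / of_nat (m + i + 1))) =
    q * (- 1) ^ (n + 1) / (of_nat (m + n + 1) * of_nat ((m + n) choose m))"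
proof -
  let ?f = "monom 1 m * [:- 1, 1:] ^ n :: 'a poly"
  have "pcompose ?f [:1, 1:] = monom 1 n * [:1, 1:] ^ m"
    by (simp add: poly_pcompose poly_monom add.commute fun_eq_iff flip: poly_eq_poly_eq_iff)
  then have "q * q_Euler_functional q (poly_antideriv (monom 1 n * [:1, 1:] ^ m)) +
      q_Euler_functional q (poly_antideriv ?f) = - q * poly (poly_antideriv ?f) 1"
    using q_Euler_functional_antideriv_shift[OF assms, of ?f] by simp
  also have "\<dots> = q * (- 1) ^ (n + 1) * (fact m * fact n / fact (m + n + 1))"
    unfolding poly_antideriv_beta_integral by simp
  also have "fact m * fact n / fact (m + n + 1) =
      1 / (of_nat (m + n + 1) * of_nat ((m + n) choose m) :: 'a)"
    by (simp add: binomial_fact field_simps del: of_nat_Suc of_nat_add)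
  finally show ?thesis
    by (simp add: q_Euler_functional_antideriv_linear_power del: of_nat_Suc of_nat_add)
qed

lemma q_Euler_binomial_sum_diagonal:
  fixes q :: "'a::field_char_0"
  assumes "q \<noteq> - 1"
  shows "(\<Sum>i\<le>k. of_nat (k choose i) * (q + (- 1) ^ i) *
      (q_Euler (2 * k - i + 1) q / of_nat (2 * k - i + 1))) =
    q * (- 1) ^ (k + 1) / (of_nat (2 * k + 1) * of_nat ((2 * k) choose k))"
proof -
  have "(\<Sum>i\<le>k. of_nat (k choose i) * (q + (- 1) ^ i) *
        (q_Euler (2 * k - i + 1) q / of_nat (2 * k - i + 1))) =
      (\<Sum>i\<le>k. of_nat (k choose i) * (q + (- 1) ^ (k - i)) *
        (q_Euler (k + i + 1) q / of_nat (k + i + 1)))"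
    by (rule sum.reindex_bij_witness[of _ "\<lambda>i. k - i" "\<lambda>i. k - i"])
      (auto simp: mult_2 simp flip: binomial_symmetric simp del: of_nat_Suc)
  also have "\<dots> = q * (- 1) ^ (k + 1) / (of_nat (k + k + 1) * of_nat ((k + k) choose k))"
    unfolding q_Euler_binomial_sum[OF assms, symmetric] sum_distrib_left sum.distrib[symmetric]
    by (rule sum.cong) (simp_all add: algebra_simps add_divide_distrib del: of_nat_Suc of_nat_add)
  finally show ?thesis
    by (simp only: mult_2)
qed

lemma padic_abs_rat_of_int_eq_1:
  assumes "\<not> int p dvd z"
  shows "padic_abs_rat p (of_int z) = 1"
proof -
  have "\<not> int p dvd 1"
    using assms by (meson dvd_trans one_dvd)
  with assms show ?thesis
    by (auto simp: padic_abs_rat_def not_dvd_imp_multiplicity_0)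
qed

lemma is_Cp_abs_of_int_eq_1:
  assumes "is_Cp p v" and "\<not> int p dvd z"
  shows "v (of_int z) = 1"
proof -
  have "v (of_rat (of_int z)) = padic_abs_rat p (of_int z)"
    using assms(1) by (simp only: is_Cp_def)
  then show ?thesis
    using assms(2) by (simp add: padic_abs_rat_of_int_eq_1)
qed

lemma is_Cp_neq_minus_1:
  assumes "is_Cp p v" and "Factorial_Ring.prime p" and "odd p" and "v (q - 1) < 1"
  shows "q \<noteq> - 1"
proof -
  have "\<not> p dvd 2"
    using assms(2,3) primes_dvd_imp_eq[OF _ two_is_prime_nat] by blast
  then have "\<not> int p dvd - 2"
    by (metis dvd_minus_iff int_dvd_int_iff of_nat_numeral)
  then have "v (of_int (- 2)) = 1"
    by (rule is_Cp_abs_of_int_eq_1[OF assms(1)])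
  then show ?thesis
    using assms(4) by auto
qed

theorem theorem2:
  fixes p k :: nat
    and v :: "'a::field_char_0 \<Rightarrow> real"
    and q :: 'a
  assumes "Factorial_Ring.prime p" and "odd p"
    and "is_Cp p v"
    and "v (q - 1) < 1"
    and "k \<ge> 1"
  shows "(1 + q) * (\<Sum>j = 0..k div 2. of_nat (k choose (2 * j)) *
             (q_Euler (2 * k - 2 * j + 1) q / of_nat (2 * k - 2 * j + 1)))
       + (q - 1) * (\<Sum>j = 0..k div 2. of_nat (k choose (2 * j + 1)) *
             (q_Euler (2 * k - 2 * j) q / of_nat (2 * k - 2 * j)))
       = q * (- 1) ^ (k + 1) / (of_nat (2 * k + 1) * of_nat ((2 * k) choose k))"
    (is "?lhs = _")
proof -
  define T where "T i = of_nat (k choose i) * (q + (- 1) ^ i) *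
      (q_Euler (2 * k - i + 1) q / of_nat (2 * k - i + 1))" for i
  have "q \<noteq> - 1"
    using assms by (intro is_Cp_neq_minus_1)
  have T_even: "T (2 * j) = (1 + q) * (of_nat (k choose (2 * j)) *
      (q_Euler (2 * k - 2 * j + 1) q / of_nat (2 * k - 2 * j + 1)))" for j
    by (simp add: T_def mult_ac add.commute del: of_nat_Suc)
  have "2 * k - Suc (2 * j) + 1 = 2 * k - 2 * j" if "j \<le> k div 2" for j
    using that assms(5) by auto
  then have T_odd: "T (Suc (2 * j)) = (q - 1) * (of_nat (k choose (2 * j + 1)) *
      (q_Euler (2 * k - 2 * j) q / of_nat (2 * k - 2 * j)))" if "j \<le> k div 2" for j
    using that by (simp only: T_def) simp
  have "?lhs = (\<Sum>j\<le>k div 2. T (2 * j) + T (Suc (2 * j)))"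
    by (simp add: T_even T_odd sum_distrib_left sum.distrib atLeast0AtMost del: of_nat_Suc)
  also have "\<dots> = (\<Sum>i\<le>Suc (2 * (k div 2)). T i)"
    by (rule sum.in_pairs_0[symmetric])
  also have "\<dots> = (\<Sum>i\<le>k. T i)"
    by (rule sum.mono_neutral_right) (auto simp: T_def)
  finally show ?thesis
    by (simp only: T_def q_Euler_binomial_sum_diagonal[OF \<open>q \<noteq> - 1\<close>])
qed

end
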